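(* For all integers $k\ge 1$ and $m\ge 0$, we have $w_{2k-1,k,m}=\binom{2k-1}{k-1}N_{k-1,m}$.
   Context: A Dyck path of semilength $n$ is a word in the letters $U,D$ with $n$ copies of each letter such that no prefix contains more $D$'s than $U$'s. A $UD$-factor (resp. $UUD$-factor) is an occurrence of $UD$ (resp. $UUD$) as a consecutive subword. $w_{n,k,m}$ denotes the number of Dyck paths of semilength $n$ with exactly $k$ $UD$-factors and exactly $m$ $UUD$-factors. The Narayana numbers are $N_{n,j}=\frac{1}{n}\binom{n}{j}\binom{n}{j-1}$ for $n\ge1$, $j\ge0$ (so $N_{n,j}=0$ unless $1\le j\le n$), and $N_{0,0}=1$, $N_{0,j}=0$ for $j\ge 1$. *)

theory Defs
  imports Complex_Main "HOL-Library.Sublist"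
begin

datatype letter = U | D

definition dyck_paths :: "nat \<Rightarrow> letter list set" where
  "dyck_paths n = {w. count_list w U = n \<and> count_list w D = n \<and>
     (\<forall>p. prefix p w \<longrightarrow> count_list p D \<le> count_list p U)}"

text \<open>Occurrences are counted by starting position, so overlapping ones count separately.\<close>

definition num_factors :: "letter list \<Rightarrow> letter list \<Rightarrow> nat" where
  "num_factors v w = card {i. i + length v \<le> length w \<and> take (length v) (drop i w) = v}"

definition dyck_count :: "nat \<Rightarrow> nat \<Rightarrow> nat \<Rightarrow> nat" where
  "dyck_count n k m =
     card {w \<in> dyck_paths n. num_factors [U, D] w = k \<and> num_factors [U, U, D] w = m}"

text \<open>The case \<open>j = 0\<close> is separate because truncated subtraction on \<^typ>\<open>nat\<close> would turn
  the vanishing binomial coefficient with lower index \<open>-1\<close> into \<open>n choose 0\<close>. Values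
  are rational so that the division is exact by definition.\<close>

definition narayana :: "nat \<Rightarrow> nat \<Rightarrow> rat" where
  "narayana n j =
     (if n = 0 then (if j = 0 then 1 else 0)
      else if j = 0 then 0
      else 1 / of_nat n * of_nat (n choose j) * of_nat (n choose (j - 1)))"

end

theory Submission
  imports Defs
begin

text \<open>
  Cut a path with \<open>k\<close> peaks into blocks \<open>U\<^sup>a D\<^sup>b\<close>. After appending one extra \<open>D\<close>, the block heights
  \<open>a - b\<close> sum to \<open>-1\<close>, and the path is a Dyck path iff all proper partial sums of the block heights
  are nonnegative. By the cycle lemma exactly one of the \<open>k\<close> rotations of any sequence of \<open>k\<close>
  blocks with total height \<open>-1\<close> has this property, so \<open>k\<close> times the number of paths is the number
  of pairs of compositions of \<open>n\<close> (with \<open>m\<close> parts at least \<open>2\<close>) and of \<open>n + 1\<close> into \<open>k\<close> parts.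
\<close>

section \<open>The cycle lemma\<close>

text \<open>The walk with the given steps, started at height \<open>h\<close>, first visits a
  negative height at its end, where it is at -1. The start height is a parameter so that inductions
  can move it along the walk.\<close>

fun first_passage :: "int \<Rightarrow> int list \<Rightarrow> bool" where
  "first_passage h [] \<longleftrightarrow> h = -1"
| "first_passage h (x # xs) \<longleftrightarrow> h \<ge> 0 \<and> first_passage (h + x) xs"

lemma first_passage_iff:
  "first_passage h xs \<longleftrightarrow>
     h + sum_list xs = -1 \<and> (\<forall>j<length xs. h + sum_list (take j xs) \<ge> 0)"
proof (induction xs arbitrary: h)
  case (Cons x xs)
  show ?case
    by (auto simp: Cons.IH All_less_Suc2 add.assoc)
qed simp

lemma first_passage_ge: "first_passage h xs \<Longrightarrow> h \<ge> -1"
  by (cases xs) auto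

text \<open>For \<open>0 < i\<close>, both \<open>take i xs\<close> and \<open>drop i xs\<close>
  would be proper prefixes of first-passage walks, hence have nonnegative sums, but together they
  sum to -1.\<close>

lemma first_passage_rotation_unique:
  assumes "first_passage 0 xs" "first_passage 0 (rotate i xs)" "i < length xs"
  shows "i = 0"
proof (rule ccontr)
  assume "i \<noteq> 0"
  have "rotate i xs = drop i xs @ take i xs"
    using assms(3) by (simp add: rotate_drop_take)
  moreover have "length xs - i < length (rotate i xs)"
    using assms(3) \<open>i \<noteq> 0\<close> by simp
  then have "sum_list (take (length xs - i) (rotate i xs)) \<ge> 0"
    using assms(2) by (simp add: first_passage_iff)
  ultimately have "sum_list (drop i xs) \<ge> 0" by simp
  moreover have "sum_list (take i xs) \<ge> 0" "sum_list xs = -1"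
    using assms(1,3) by (auto simp: first_passage_iff)
  moreover have "sum_list xs = sum_list (take i xs) + sum_list (drop i xs)"
    by (metis append_take_drop_id sum_list_append)
  ultimately show False by simp
qed

text \<open>Cut at the first position in \<open>{0<..length xs}\<close> where the partial sums
  attain their minimum. The value \<open>j = length xs\<close> stands for the trivial
  rotation.\<close>

lemma first_passage_rotation_exists:
  assumes "sum_list xs = -1"
  obtains j where "0 < j" "j \<le> length xs" "first_passage 0 (drop j xs @ take j xs)"
proof -
  define S where "S j = sum_list (take j xs)" for j
  let ?k = "length xs"
  have "?k > 0" using assms by (cases xs) auto
  define M where "M = Min (S ` {0<..?k})"
  have M_le: "M \<le> S j" if "0 < j" "j \<le> ?k" for j
    unfolding M_def using that by (intro Min_le) auto
  have "M \<in> S ` {0<..?k}"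
    unfolding M_def using \<open>?k > 0\<close> by (intro Min_in) auto
  then obtain j0 where "0 < j0 \<and> j0 \<le> ?k \<and> S j0 = M" by auto
  define j where "j = (LEAST j. 0 < j \<and> j \<le> ?k \<and> S j = M)"
  have j: "0 < j" "j \<le> ?k" "S j = M"
    using LeastI[of "\<lambda>j. 0 < j \<and> j \<le> ?k \<and> S j = M" j0, folded j_def] \<open>0 < j0 \<and> _\<close> by auto
  have Sk: "S ?k = -1" using assms by (simp add: S_def)
  then have "M \<le> -1" using M_le[of ?k] \<open>?k > 0\<close> by simp
  have M_less: "M < S t" if "t < j" for t
  proof (cases "t = 0")
    case True
    then show ?thesis using \<open>M \<le> -1\<close> by (simp add: S_def)
  next
    case False
    then have "S t \<noteq> M"
      using not_less_Least[of t "\<lambda>j. 0 < j \<and> j \<le> ?k \<and> S j = M", folded j_def] that j by auto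
    then show ?thesis using M_le[of t] False that j by simp
  qed
  have split: "sum_list (drop i xs) = -1 - S i" for i
    using assms by (metis S_def add_diff_cancel_left' append_take_drop_id sum_list_append)
  have S_add: "sum_list (take t (drop j xs)) = S (j + t) - S j" for t
    by (simp add: S_def take_add)
  have "first_passage 0 (drop j xs @ take j xs)"
    unfolding first_passage_iff
  proof (intro conjI allI impI)
    show "0 + sum_list (drop j xs @ take j xs) = -1"
      using split[of j] by (simp add: S_def)
  next
    fix t assume t: "t < length (drop j xs @ take j xs)"
    show "0 + sum_list (take t (drop j xs @ take j xs)) \<ge> 0"
    proof (cases "j + t \<le> ?k")
      case True
      then show ?thesis using M_le[of "j + t"] j S_add[of t] by simp
    next
      \<comment> \<open>The prefix wraps around and has sum \<open>-1 - M + S s\<close>. Since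
        \<open>j\<close> is the first minimum, \<open>S s > M\<close> strictly, and over the
        integers this makes the sum nonnegative.\<close>
      case False
      define s where "s = t - (?k - j)"
      have "s < j" using t False j by (simp add: s_def)
      have "take t (drop j xs @ take j xs) = drop j xs @ take s xs"
        using False \<open>s < j\<close> by (simp add: s_def min_def)
      then show ?thesis
        using M_less[OF \<open>s < j\<close>] split[of j] j by (simp add: S_def)
    qed
  qed
  then show ?thesis using that j by blast
qed

lemma inj_rotate: "inj (rotate n)"
  unfolding rotate_def by (rule inj_fn[OF inj_rotate1])

text \<open>Pairing a first-passage list with a rotation amount below \<open>k\<close> gives each
  list of \<open>S\<close> exactly once. Through \<open>f\<close> the list entries may carry more
  data than their step size.\<close>

lemma cycle_lemma:
  fixes f :: "'a \<Rightarrow> int"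
  assumes rotate: "\<And>xs i. xs \<in> S \<Longrightarrow> rotate i xs \<in> S"
    and len: "\<And>xs. xs \<in> S \<Longrightarrow> length xs = k"
    and total: "\<And>xs. xs \<in> S \<Longrightarrow> sum_list (map f xs) = -1"
  shows "card S = k * card {xs \<in> S. first_passage 0 (map f xs)}" (is "_ = k * card ?G")
proof -
  have unique: "i = j \<and> xs = ys"
    if "xs \<in> ?G" "ys \<in> ?G" "i \<le> j" "j < k" "rotate i xs = rotate j ys" for xs ys i j
  proof -
    \<comment> \<open>Cancelling the common rotation by \<open>i\<close> makes \<open>xs\<close> a
      rotation of \<open>ys\<close> by \<open>j - i < k\<close>.\<close>
    have "rotate i xs = rotate i (rotate (j - i) ys)"
      using that by (simp add: rotate_rotate)
    then have xs: "xs = rotate (j - i) ys"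
      using inj_rotate by (auto dest: injD)
    have "j - i = 0"
      using that len[of ys] xs
      by (intro first_passage_rotation_unique[of "map f ys"]) (auto simp: rotate_map)
    then show ?thesis using that xs by simp
  qed
  have "bij_betw (\<lambda>(xs, i). rotate i xs) (?G \<times> {..<k}) S"
    unfolding bij_betw_def
  proof (intro conjI equalityI subsetI)
    show "inj_on (\<lambda>(xs, i). rotate i xs) (?G \<times> {..<k})"
    proof (rule inj_onI, clarsimp)
      fix xs i ys j
      assume "xs \<in> S" "first_passage 0 (map f xs)" "i < k" "ys \<in> S"
        "first_passage 0 (map f ys)" "j < k" "rotate i xs = rotate j ys"
      then show "xs = ys \<and> i = j"
        using unique[of xs ys i j] unique[of ys xs j i] by (cases "i \<le> j") auto
    qed
  next
    fix xs assume "xs \<in> (\<lambda>(xs, i). rotate i xs) ` (?G \<times> {..<k})"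
    then show "xs \<in> S" using rotate by auto
  next
    fix xs assume xs: "xs \<in> S"
    then obtain j where j: "0 < j" "j \<le> k"
      "first_passage 0 (drop j (map f xs) @ take j (map f xs))"
      using first_passage_rotation_exists[OF total] len by (metis length_map)
    define ys where "ys = drop j xs @ take j xs"
    have "rotate j xs = ys"
      using j len[OF xs] unfolding ys_def
      by (cases "j = k") (auto simp: rotate_drop_take)
    then have "ys \<in> ?G" using j rotate[OF xs, of j]
      by (auto simp: ys_def drop_map take_map)
    \<comment> \<open>Rotating by the remaining \<open>k - j\<close> completes a full turn;
      \<open>0 < j\<close> gives \<open>k - j < k\<close>.\<close>
    moreover have "rotate (k - j) ys = xs"
      using len[OF xs] j rotate_append[of "drop j xs" "take j xs"] by (simp add: ys_def)
    ultimately show "xs \<in> (\<lambda>(xs, i). rotate i xs) ` (?G \<times> {..<k})"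
      using j by (intro image_eqI[of _ _ "(ys, k - j)"]) auto
  qed
  then have "card S = card (?G \<times> {..<k})" by (simp add: bij_betw_same_card)
  then show ?thesis by (simp add: card_cartesian_product)
qed

section \<open>Counting compositions\<close>

abbreviation support_size :: "nat list \<Rightarrow> nat" where
  "support_size xs \<equiv> length (filter (\<lambda>x. x \<noteq> 0) xs)"

lemma finite_sum_list_eq: "finite {xs :: nat list. length xs = k \<and> sum_list xs = s \<and> P xs}"
proof (rule finite_subset)
  show "{xs. length xs = k \<and> sum_list xs = s \<and> P xs} \<subseteq> {xs. set xs \<subseteq> {..s} \<and> length xs = k}"
    using member_le_sum_list by fastforce
qed (simp add: finite_lists_length_eq)

lemma card_sum_zero:
  "card {xs :: nat list. length xs = k \<and> sum_list xs = 0 \<and> support_size xs = m}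
     = (if m = 0 then 1 else 0)"
proof -
  have "{xs :: nat list. length xs = k \<and> sum_list xs = 0 \<and> support_size xs = m}
      = (if m = 0 then {replicate k 0} else {})"
    by (auto simp: filter_empty_conv intro: replicate_eqI)
  then show ?thesis by simp
qed

lemma card_support_zero:
  "card {xs. length xs = k \<and> sum_list xs = s \<and> support_size xs = 0} = (if s = 0 then 1 else 0)"
proof (cases "s = 0")
  case True
  then show ?thesis using card_sum_zero[of k 0] by simp
next
  case False
  have "support_size xs = 0 \<longleftrightarrow> sum_list xs = 0" for xs
    by (auto simp: filter_empty_conv)
  then have "\<not> (sum_list xs = s \<and> support_size xs = 0)" for xs
    using False by metis
  then have "{xs. length xs = k \<and> sum_list xs = s \<and> support_size xs = 0} = {}"
    by blast
  then show ?thesis using False by (simp only: card.empty if_False)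
qed

text \<open>Choose the \<open>Suc m\<close> nonzero positions, then write \<open>Suc s\<close> as an
  ordered sum of \<open>Suc m\<close> positive parts in \<open>s choose m\<close> ways. The formal
  proof removes the first entry and ends with Pascal's rule.\<close>

lemma card_compositions_support:
  "card {xs. length xs = k \<and> sum_list xs = Suc s \<and> support_size xs = Suc m}
     = (k choose Suc m) * (s choose m)"
proof (induction k arbitrary: s m)
  case 0
  then show ?case by simp
next
  case (Suc k)
  define F where
    "F s m = {xs :: nat list. length xs = k \<and> sum_list xs = s \<and> support_size xs = m}" for s m
  have fin: "finite (F s m)" for s m
    unfolding F_def by (rule finite_sum_list_eq)
  \<comment> \<open>This counts the tails left after a nonzero first entry. The induction hypothesis
    covers only positive sum and positive support, so \<open>m = 0\<close> and the term
    \<open>i = 0\<close> are separate; the rest is the hockey-stick identity.\<close>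
  have partial: "(\<Sum>i\<le>s. card (F i m)) = (k choose m) * (s choose m)"
  proof (cases m)
    case 0
    then show ?thesis unfolding F_def 0 card_support_zero by simp
  next
    case (Suc m')
    have "card (F 0 m) = 0"
      unfolding F_def card_sum_zero by (simp add: Suc)
    then have "(\<Sum>i\<le>s. card (F i m)) = (\<Sum>i<s. card (F (Suc i) m))"
      by (simp add: sum.atMost_shift)
    moreover have "card (F (Suc i) m) = (k choose m) * (i choose m')" for i
      unfolding F_def Suc by (rule Suc.IH)
    then have "(\<Sum>i<s. card (F (Suc i) m)) = (k choose m) * (\<Sum>i<s. i choose m')"
      by (simp add: sum_distrib_left)
    moreover have "(\<Sum>i<s. i choose m') = s choose m"
      by (cases s) (simp_all add: Suc lessThan_Suc_atMost sum_choose_upper)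
    ultimately show ?thesis by simp
  qed
  \<comment> \<open>The first entry is zero, or it is \<open>Suc (s - i)\<close> where
    \<open>i \<le> s\<close> is the sum of the tail.\<close>
  have "{xs. length xs = Suc k \<and> sum_list xs = Suc s \<and> support_size xs = Suc m}
      = (#) 0 ` F (Suc s) (Suc m) \<union> (\<Union>i\<le>s. (#) (Suc (s - i)) ` F i m)" (is "?L = ?A \<union> ?B")
  proof (intro equalityI subsetI)
    fix xs assume "xs \<in> ?L"
    then obtain x ys where xs: "xs = x # ys" "length ys = k" "x + sum_list ys = Suc s"
      "support_size (x # ys) = Suc m"
      by (cases xs) auto
    show "xs \<in> ?A \<union> ?B"
    proof (cases x)
      case 0
      then show ?thesis using xs by (auto simp: F_def)
    next
      case (Suc x')
      then have "s - sum_list ys = x'" "sum_list ys \<le> s" "ys \<in> F (sum_list ys) m"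
        using xs by (auto simp: F_def)
      then show ?thesis using xs(1) Suc by blast
    qed
  qed (auto simp: F_def)
  moreover have "card ?A = (k choose Suc m) * (s choose m)"
    unfolding F_def Suc.IH[symmetric] by (rule card_image) simp
  moreover have "card ?B = (\<Sum>i\<le>s. card (F i m))"
    by (subst card_UN_disjoint) (auto simp: fin card_image)
  moreover have "card (?A \<union> ?B) = card ?A + card ?B"
    by (rule card_Un_disjoint) (auto simp: fin)
  ultimately show ?case
    by (simp only: partial) (simp add: algebra_simps)
qed

section \<open>Block decomposition of paths\<close>

text \<open>The pair \<open>(a, b)\<close> encodes the block \<open>U\<^sup>a\<^sup>+\<^sup>1 D\<^sup>b\<^sup>+\<^sup>1\<close>.\<close>

fun blocks :: "(nat \<times> nat) list \<Rightarrow> letter list" where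
  "blocks [] = []"
| "blocks ((a, b) # ps) = replicate (Suc a) U @ replicate (Suc b) D @ blocks ps"

fun step :: "letter \<Rightarrow> int" where
  "step U = 1"
| "step D = -1"

text \<open>The net rise of a block: the two shifts by one in its encoding cancel.\<close>

abbreviation height :: "nat \<times> nat \<Rightarrow> int" where
  "height p \<equiv> int (fst p) - int (snd p)"

text \<open>The side conditions make the leading run of \<open>x\<close> maximal, so its length is
  determined by the word.\<close>

lemma replicate_append_eq_iff:
  assumes "xs = [] \<or> hd xs \<noteq> x" "ys = [] \<or> hd ys \<noteq> x"
  shows "replicate a x @ xs = replicate b x @ ys \<longleftrightarrow> a = b \<and> xs = ys"
  using assms
proof (induction a arbitrary: b)
  case 0
  then show ?case by (cases b) auto
next
  case (Suc a)
  then show ?case by (cases b) auto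
qed

lemma hd_blocks: "blocks ps = [] \<or> hd (blocks ps) \<noteq> D"
  by (cases ps rule: blocks.cases) auto

lemma inj_blocks: "inj blocks"
proof (rule injI)
  show "blocks ps = blocks qs \<Longrightarrow> ps = qs" for ps qs
  proof (induction ps arbitrary: qs rule: blocks.induct)
    case 1
    then show ?case by (cases qs rule: blocks.cases) auto
  next
    case (2 a b ps)
    then obtain a' b' qs' where qs: "qs = (a', b') # qs'"
      by (cases qs rule: blocks.cases) auto
    have "replicate (Suc a) U @ replicate (Suc b) D @ blocks ps
        = replicate (Suc a') U @ replicate (Suc b') D @ blocks qs'"
      using 2(2) qs by simp
    then have "Suc a = Suc a' \<and> replicate (Suc b) D @ blocks ps = replicate (Suc b') D @ blocks qs'"
      by (subst (asm) replicate_append_eq_iff) auto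
    then have "a = a'" "Suc b = Suc b' \<and> blocks ps = blocks qs'"
      using replicate_append_eq_iff[OF hd_blocks hd_blocks] by auto
    then show ?case using 2(1) qs by simp
  qed
qed

text \<open>The leading run of \<open>D\<close> is there for the induction: removing the first
  letters of a block word can leave a suffix that starts inside a descent.\<close>

lemma ends_with_D_blocks:
  assumes "w = [] \<or> last w = D"
  shows "\<exists>b ps. w = replicate b D @ blocks ps"
  using assms
proof (induction w)
  case Nil
  have "[] = replicate 0 D @ blocks []" by simp
  then show ?case by blast
next
  case (Cons x w)
  then obtain b ps where w: "w = replicate b D @ blocks ps"
    by (auto split: if_splits)
  show ?case
  proof (cases x)
    case D
    then have "x # w = replicate (Suc b) D @ blocks ps" using w by simp
    then show ?thesis by blast
  next
    case U
    then have "w \<noteq> []" using Cons.prems by auto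
    \<comment> \<open>For \<open>b = 0\<close> the new \<open>U\<close> lengthens the first ascent;
      otherwise it forms a new first block with the leading run of \<open>D\<close>.\<close>
    have "\<exists>qs. x # w = blocks qs"
    proof (cases b)
      case 0
      then obtain a' b' ps' where "ps = (a', b') # ps'"
        using w \<open>w \<noteq> []\<close> by (cases ps rule: blocks.cases) auto
      then have "x # w = blocks ((Suc a', b') # ps')" using w 0 U by simp
      then show ?thesis by blast
    next
      case (Suc b')
      then have "x # w = blocks ((0, b') # ps)" using w U by simp
      then show ?thesis by blast
    qed
    then show ?thesis by (metis append_Nil replicate_0)
  qed
qed

section \<open>First passage of a word, read off its blocks\<close>

lemma first_passage_up:
  "h \<ge> 0 \<Longrightarrow> first_passage h (map step (replicate a U @ w)) = first_passage (h + int a) (map step w)"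
  by (induction a arbitrary: h) (auto simp: algebra_simps)

lemma first_passage_down:
  "h \<ge> 0 \<Longrightarrow> first_passage h (map step (replicate b D @ w)) = first_passage (h - int b) (map step w)"
proof (induction b arbitrary: h)
  case (Suc b)
  show ?case
  proof (cases "h = 0")
    \<comment> \<open>After one \<open>D\<close> the height is already -1. If more follow, the left
      side fails, and so does the right, whose start height is below -1.\<close>
    case True
    then show ?thesis
      by (cases b) (auto dest: first_passage_ge)
  next
    case False
    then show ?thesis using Suc by (simp add: algebra_simps)
  qed
qed simp

text \<open>Within a block the lowest point is one of its two ends, so only the heights between
  blocks matter.\<close>

lemma first_passage_blocks:
  "first_passage h (map step (blocks ps)) = first_passage h (map height ps)"
proof (induction ps arbitrary: h rule: blocks.induct)
  case (2 a b ps)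
  show ?case
  proof (cases "h \<ge> 0")
    case True
    have "first_passage h (map step (blocks ((a, b) # ps)))
        = first_passage (h + int (Suc a) - int (Suc b)) (map step (blocks ps))"
      unfolding blocks.simps using True
      by (simp only: first_passage_up first_passage_down)
    also have "\<dots> = first_passage (h + (int a - int b)) (map height ps)"
      by (simp add: 2)
    finally show ?thesis using True by simp
  qed simp
qed simp

text \<open>The proper prefixes of \<open>w @ [D]\<close> are the prefixes of \<open>w\<close>, and
  the extra \<open>D\<close> turns a final height 0 into -1.\<close>

lemma first_passage_append_D:
  "first_passage h (map step (w @ [D])) \<longleftrightarrow>
     h + int (count_list w U) = int (count_list w D) \<and>
     (\<forall>p. prefix p w \<longrightarrow> h + int (count_list p U) \<ge> int (count_list p D))"
proof (induction w arbitrary: h)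
  case (Cons x w)
  have prefixes: "(\<forall>p. prefix p (x # w) \<longrightarrow> P p) \<longleftrightarrow> P [] \<and> (\<forall>p. prefix p w \<longrightarrow> P (x # p))"
    for P
    by (auto simp: prefix_Cons)
  show ?case
    unfolding prefixes using Cons.IH[of "h + 1"] Cons.IH[of "h - 1"]
    by (cases x) (simp_all add: algebra_simps conj_left_commute)
qed auto

lemma dyck_paths_iff:
  "w \<in> dyck_paths n \<longleftrightarrow> count_list w U = n \<and> first_passage 0 (map step (w @ [D]))"
  unfolding first_passage_append_D dyck_paths_def by auto

lemma count_list_blocks:
  "count_list (blocks ps) U = length ps + sum_list (map fst ps)"
proof (induction ps rule: blocks.induct)
  case (2 a b ps)
  have "count_list (replicate i x) y = (if x = y then i else 0)" for i and x y :: letter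
    by (induction i) auto
  with 2 show ?case by simp
qed simp

section \<open>Counting factors\<close>

lemma num_factors_Nil: "v \<noteq> [] \<Longrightarrow> num_factors v [] = 0"
  by (simp add: num_factors_def)

text \<open>Separates an occurrence at position 0 from the later ones, which shift by one; this
  makes the positional definition usable in inductions.\<close>

lemma num_factors_Cons:
  assumes "v \<noteq> []"
  shows "num_factors v (x # xs) = (if prefix v (x # xs) then 1 else 0) + num_factors v xs"
proof -
  define P where "P ys i \<longleftrightarrow> i + length v \<le> length ys \<and> take (length v) (drop i ys) = v" for ys i
  have fin: "finite {i. P ys i}" for ys
    by (rule finite_subset[of _ "{..length ys}"]) (auto simp: P_def)
  have "{i. P (x # xs) i} = (if prefix v (x # xs) then {0} else {}) \<union> Suc ` {i. P xs i}"
  proof (rule set_eqI)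
    fix i
    show "i \<in> {i. P (x # xs) i} \<longleftrightarrow>
        i \<in> (if prefix v (x # xs) then {0} else {}) \<union> Suc ` {i. P xs i}"
    proof (cases i)
      case 0
      have "P (x # xs) 0 \<longleftrightarrow> prefix v (x # xs)"
        unfolding P_def
        by (metis add_0 append_eq_conv_conj drop0 prefix_def prefix_length_le take_is_prefix)
      then show ?thesis using 0 by auto
    qed (auto simp: P_def)
  qed
  moreover have "card ((if prefix v (x # xs) then {0} else {}) \<union> Suc ` {i. P xs i})
      = (if prefix v (x # xs) then 1 else 0) + card {i. P xs i}"
    by (subst card_Un_disjoint) (auto simp: fin card_image)
  ultimately show ?thesis by (simp add: num_factors_def P_def)
qed

lemmas num_factors_simps = num_factors_Nil num_factors_Cons

text \<open>Both factors end in \<open>UD\<close>, so a \<open>D\<close> placed after a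
  \<open>D\<close> completes no new occurrence.\<close>

lemma num_factors_extra_D:
  assumes "v \<in> {[U, D], [U, U, D]}" "w = [] \<or> last w = D"
  shows "num_factors v (w @ [D]) = num_factors v w"
  using assms(2)
proof (induction w)
  case Nil
  then show ?case using assms(1) by (auto simp: num_factors_simps)
next
  case (Cons x w)
  have "prefix v (x # w @ [D]) \<longleftrightarrow> prefix v (x # w)"
    using Cons.prems assms(1)
    by (cases w; cases "tl w") (auto simp: Cons_prefix_Cons)
  then show ?case using Cons assms(1)
    by (cases "w = []") (auto simp: num_factors_Cons)
qed

lemma num_factors_down:
  assumes "v = U # v'"
  shows "num_factors v (replicate b D @ w) = num_factors v w"
  using assms by (induction b) (auto simp: num_factors_Cons)

lemma num_UD_blocks: "num_factors [U, D] (blocks ps) = length ps"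
proof (induction ps rule: blocks.induct)
  case (2 a b ps)
  have "num_factors [U, D] (replicate (Suc a) U @ D # w) = Suc (num_factors [U, D] w)" for w
    by (induction a) (auto simp: num_factors_Cons)
  from this[of "replicate b D @ blocks ps"] show ?case
    using 2 by (simp add: num_factors_down)
qed (simp add: num_factors_Nil)

text \<open>The only candidate in a block is at its peak, and it occurs iff the ascent has length
  \<open>Suc a\<close> at least 2, that is, \<open>a \<noteq> 0\<close>.\<close>

lemma num_UUD_blocks: "num_factors [U, U, D] (blocks ps) = support_size (map fst ps)"
proof (induction ps rule: blocks.induct)
  case (2 a b ps)
  have *: "num_factors [U, U, D] (replicate (Suc (Suc a)) U @ D # w)
      = Suc (num_factors [U, U, D] w)" for a w
  proof (induction a)
    case (Suc a)
    then show ?case by (subst replicate_Suc) (simp add: num_factors_Cons)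
  qed (simp add: num_factors_Cons)
  show ?case
  proof (cases a)
    case 0
    then show ?thesis using 2 by (simp add: num_factors_Cons num_factors_down)
  next
    case (Suc a')
    then show ?thesis
      using 2 *[of a' "replicate b D @ blocks ps"] by (simp add: num_factors_down)
  qed
qed (simp add: num_factors_Nil)

section \<open>Counting paths by peaks\<close>

lemma dyck_count_blocks:
  assumes "n \<ge> 1"
  shows "dyck_count n k m = card {ps. length ps = k \<and> k + sum_list (map fst ps) = n \<and>
           support_size (map fst ps) = m \<and> first_passage 0 (map height ps)}"
    (is "_ = card ?G")
proof -
  let ?W = "{w \<in> dyck_paths n. num_factors [U, D] w = k \<and> num_factors [U, U, D] w = m}"
  have last_D: "last w = D" if "w \<in> dyck_paths n" for w
  proof (rule ccontr)
    assume "last w \<noteq> D"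
    moreover have "w \<noteq> []" using that assms by (auto simp: dyck_paths_def)
    ultimately obtain u where u: "w = u @ [U]"
      by (metis append_butlast_last_id letter.exhaust)
    then have "count_list u D \<le> count_list u U" "count_list u U < count_list u D"
      using that by (auto simp: dyck_paths_def)
    then show False by simp
  qed
  \<comment> \<open>Both maps are injective, so equality of the images yields equality of the
    cardinalities.\<close>
  have "(\<lambda>w. w @ [D]) ` ?W = blocks ` ?G"
  proof (intro equalityI subsetI)
    fix v assume "v \<in> (\<lambda>w. w @ [D]) ` ?W"
    then obtain w where w: "v = w @ [D]" "w \<in> ?W" by blast
    then have "w = [] \<or> last w = D" using last_D by blast
    then have num: "num_factors [U, D] v = k" "num_factors [U, U, D] v = m"
      using w by (auto simp: num_factors_extra_D)
    obtain b ps where v: "v = replicate b D @ blocks ps"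
      using ends_with_D_blocks[of v] w by auto
    have fp: "first_passage 0 (map step v)" and cU: "count_list w U = n"
      using w by (auto simp: dyck_paths_iff)
    \<comment> \<open>A leading \<open>D\<close> reaches -1 at once, so it would be the whole word
      and \<open>w\<close> would be empty, against \<open>n \<ge> 1\<close>.\<close>
    have "b = 0"
    proof (rule ccontr)
      assume "b \<noteq> 0"
      then obtain r where r: "v = D # r" using v by (cases b) auto
      then have "first_passage (-1) (map step r)" using fp by simp
      then have "r = []" by (cases r) auto
      then have "w = []" using w r by simp
      then show False using cU assms by simp
    qed
    then have v: "v = blocks ps" using v by simp
    moreover have "count_list v U = n" using w cU by simp
    ultimately have "ps \<in> ?G"
      using fp num count_list_blocks[of ps]
      by (auto simp: num_UD_blocks num_UUD_blocks first_passage_blocks)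
    then show "v \<in> blocks ` ?G" using v by blast
  next
    fix v assume "v \<in> blocks ` ?G"
    then obtain ps where ps: "v = blocks ps" "ps \<in> ?G" by blast
    then have fp: "first_passage 0 (map step v)" by (simp add: first_passage_blocks)
    then have "v \<noteq> []" by auto
    \<comment> \<open>A final \<open>U\<close> ending at -1 would start from height -2, which first
      passage excludes.\<close>
    have last: "last v = D"
    proof (rule ccontr)
      assume "last v \<noteq> D"
      then obtain u where "v = u @ [U]"
        using \<open>v \<noteq> []\<close> by (metis append_butlast_last_id letter.exhaust)
      then have "sum_list (map step v) = sum_list (map step u) + 1"
        "sum_list (take (length u) (map step v)) = sum_list (map step u)"
        "length u < length v" by auto
      then show False using fp by (auto simp: first_passage_iff)
    qed
    then obtain w where w: "v = w @ [D]"
      using \<open>v \<noteq> []\<close> by (metis append_butlast_last_id)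
    have "count_list v U = n"
      using ps count_list_blocks[of ps] by auto
    then have "count_list w U = n"
      using w by simp
    then have "w \<in> dyck_paths n" using fp w by (simp add: dyck_paths_iff)
    moreover from this have "w = [] \<or> last w = D" using last_D by blast
    then have "num_factors [U, D] w = k" "num_factors [U, U, D] w = m"
      using ps w num_factors_extra_D[of _ w] num_UD_blocks[of ps] num_UUD_blocks[of ps] by auto
    ultimately show "v \<in> (\<lambda>w. w @ [D]) ` ?W" using w by blast
  qed
  moreover have "card ((\<lambda>w. w @ [D]) ` ?W) = card ?W"
    by (rule card_image) (simp add: inj_on_def)
  moreover have "card (blocks ` ?G) = card ?G"
    by (rule card_image[OF inj_on_subset[OF inj_blocks subset_UNIV]])
  ultimately show ?thesis
    unfolding dyck_count_def by simp
qed

lemma dyck_count_cycle: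
  assumes "k \<ge> 1"
  shows "k * dyck_count (s + k) k m =
    card {xs. length xs = k \<and> sum_list xs = s \<and> support_size xs = m} * ((s + k) choose (k - 1))"
proof -
  \<comment> \<open>The second components sum to \<open>Suc s\<close> because of the appended
    \<open>D\<close>, so the heights total -1. All conditions are invariant under rotation.\<close>
  define S where "S = {ps :: (nat \<times> nat) list. length ps = k \<and> sum_list (map fst ps) = s \<and>
    sum_list (map snd ps) = Suc s \<and> support_size (map fst ps) = m}"
  let ?A = "{xs. length xs = k \<and> sum_list xs = s \<and> support_size xs = m}"
  let ?B = "{xs :: nat list. length xs = k \<and> sum_list xs = Suc s}"
  have height_sum: "sum_list (map height ps) = int (sum_list (map fst ps)) - int (sum_list (map snd ps))"
    for ps :: "(nat \<times> nat) list"
    by (induction ps) auto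
  have sum_rotate: "sum_list (rotate i xs) = sum_list xs" for i and xs :: "nat list"
    by (metis add.commute append_take_drop_id rotate_drop_take sum_list_append)
  have support_rotate: "support_size (rotate i xs) = support_size xs" for i xs
    by (metis add.commute append_take_drop_id rotate_drop_take filter_append length_append)
  have "card S = k * card {ps \<in> S. first_passage 0 (map height ps)}"
  proof (rule cycle_lemma)
    fix ps i assume "ps \<in> S"
    then show "rotate i ps \<in> S"
      unfolding S_def mem_Collect_eq rotate_map[symmetric] sum_rotate support_rotate length_rotate .
  qed (auto simp: S_def height_sum)
  \<comment> \<open>The sum of the second components is implied here: first passage from 0 forces
    total height -1.\<close>
  also have "{ps \<in> S. first_passage 0 (map height ps)}
      = {ps. length ps = k \<and> k + sum_list (map fst ps) = s + k \<and>
           support_size (map fst ps) = m \<and> first_passage 0 (map height ps)}"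
    by (auto simp: S_def first_passage_iff height_sum)
  also have "card \<dots> = dyck_count (s + k) k m"
    using assms by (subst dyck_count_blocks) auto
  finally have "k * dyck_count (s + k) k m = card S" by simp
  also have "card S = card (?A \<times> ?B)"
  proof (rule bij_betw_same_card, rule bij_betw_byWitness)
    show "\<forall>ps\<in>S. (case (map fst ps, map snd ps) of (as, bs) \<Rightarrow> zip as bs) = ps"
      by (auto simp: zip_map_fst_snd)
    show "\<forall>p\<in>?A \<times> ?B. (\<lambda>ps. (map fst ps, map snd ps)) (case p of (as, bs) \<Rightarrow> zip as bs) = p"
      by auto
    show "(\<lambda>ps. (map fst ps, map snd ps)) ` S \<subseteq> ?A \<times> ?B"
      by (auto simp: S_def)
    show "(\<lambda>(as, bs). zip as bs) ` (?A \<times> ?B) \<subseteq> S"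
      by (auto simp: S_def simp del: length_filter_map)
  qed
  also have "\<dots> = card ?A * card ?B" by (rule card_cartesian_product)
  also have "card ?B = (s + k) choose Suc s"
    using assms by (simp add: card_length_sum_list)
  also have "\<dots> = (s + k) choose (k - 1)"
    using assms by (subst binomial_symmetric) auto
  finally show ?thesis .
qed

text \<open>Supplies the factor \<open>k\<close> that cancels the one from the cycle lemma. The case
  \<open>k = 1\<close> rests on the convention for \<open>narayana 0\<close>.\<close>

lemma narayana_support:
  assumes "k \<ge> 1"
  shows "of_nat (card {xs. length xs = k \<and> sum_list xs = k - 1 \<and> support_size xs = m})
           = of_nat k * narayana (k - 1) m"
proof (cases "k = 1")
  case True
  then show ?thesis using card_sum_zero[of 1 m] by (simp add: narayana_def)
next
  case False
  then obtain r where k: "k = Suc (Suc r)"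
    using assms by (metis One_nat_def Suc_le_D le_SucE not_less_eq_eq)
  show ?thesis
  proof (cases m)
    case 0
    then show ?thesis using card_support_zero[of k "k - 1"] k by (simp add: narayana_def)
  next
    case (Suc l)
    \<comment> \<open>By the absorption identity, used once on each side, both sides equal
      \<open>(Suc (Suc r) choose Suc l) * (Suc r choose Suc l) * Suc l\<close>.\<close>
    have "Suc r * ((Suc (Suc r) choose Suc l) * (r choose l))
        = Suc (Suc r) * ((Suc r choose Suc l) * (Suc r choose l))"
    proof (cases "l \<le> r")
      case True
      have "Suc (Suc r) * (Suc r choose l) = (Suc (Suc r) choose Suc l) * Suc l"
        by (rule Suc_times_binomial_eq)
      moreover have "Suc r * (r choose l) = (Suc r choose Suc l) * Suc l"
        by (rule Suc_times_binomial_eq)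
      ultimately have "(Suc (Suc r) choose Suc l) * (Suc r * (r choose l))
          = (Suc r choose Suc l) * (Suc (Suc r) * (Suc r choose l))"
        by (simp only: mult_ac)
      then show ?thesis
        by (simp only: mult_ac)
    qed (simp add: binomial_eq_0)
    then have "of_nat (Suc r) * (of_nat (Suc (Suc r) choose Suc l) * of_nat (r choose l) :: rat)
        = of_nat (Suc (Suc r)) * (of_nat (Suc r choose Suc l) * of_nat (Suc r choose l))"
      by (metis of_nat_mult)
    then have "of_nat (Suc (Suc r) choose Suc l) * of_nat (r choose l)
        = of_nat k * narayana (k - 1) m"
      using k Suc
      by (simp add: narayana_def nonzero_eq_divide_eq del: of_nat_Suc binomial_Suc_Suc)
         (simp add: mult_ac)
    then show ?thesis
      using card_compositions_support[of k r l] k Suc by simp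
  qed
qed

theorem theorem4p7:
  fixes k m :: nat
  assumes "k \<ge> 1"
  shows "of_nat (dyck_count (2 * k - 1) k m)
           = of_nat ((2 * k - 1) choose (k - 1)) * narayana (k - 1) m"
proof -
  \<comment> \<open>Semilength \<open>2 * k - 1\<close> is the case \<open>s = k - 1\<close>, in
    which the count of first components is the one evaluated by
    \<open>narayana_support\<close>.\<close>
  have "k - 1 + k = 2 * k - 1" using assms by simp
  then have "of_nat k * of_nat (dyck_count (2 * k - 1) k m)
      = of_nat k * (of_nat ((2 * k - 1) choose (k - 1)) * narayana (k - 1) m)"
    using dyck_count_cycle[OF assms, of "k - 1" m, THEN arg_cong, of "of_nat :: nat \<Rightarrow> rat"]
      narayana_support[OF assms, of m]
    by (simp add: mult_ac)
  then show ?thesis using assms by simp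
qed

end
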